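(* Let $\alpha>-1$, $a\in\mathbb R$, $a\ne0$, and $$W(x)=e^{-x}x^{\alpha}\begin{pmatrix}x(1+a^2x)&ax\\ ax&1\end{pmatrix},\qquad x\in(0,\infty).$$ For $\beta>-1$ let $L_n^{\beta}$, $n\ge0$, be the sequence of monic orthogonal polynomials for the scalar Laguerre weight $e^{-x}x^{\beta}$ on $(0,\infty)$. Then $$Q_n(x)=\begin{pmatrix}-\frac1aL_n^{\alpha+1}(x)&(\alpha+1)L_n^{\alpha+1}(x)+x(L_n^{\alpha+1})'(x)\\ -(L_n^{\alpha})'(x)&\frac1aL_n^{\alpha}(x)+ax(L_n^{\alpha})'(x)\end{pmatrix},\qquad n\ge0,$$ is a sequence of orthogonal polynomials for $W$.
   Context: A sequence of (matrix-valued) orthogonal polynomials for a weight matrix $W$ of size $N$ on $(x_0,x_1)$ is a sequence $Q_n\in\operatorname{Mat}_N(\mathbb C[x])$, $n\ge0$, such that $Q_n$ has degree $n$ with nonsingular leading coefficient and $\int_{x_0}^{x_1}Q_n(x)W(x)Q_m(x)^*\,dx=0$ for $n\neq m$. *)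

theory Defs
  imports "HOL-Analysis.Analysis" "HOL-Computational_Algebra.Polynomial"
begin

text \<open>Matrix polynomials, i.e. elements of \<open>Mat\<^sub>N(\<complex>[x])\<close>, are matrices of polynomials.\<close>

type_synonym 'n matpoly = "complex poly ^ 'n ^ 'n"

definition mateval :: "'n::finite matpoly \<Rightarrow> real \<Rightarrow> complex ^ 'n ^ 'n" where
  "mateval Q x = map_matrix (\<lambda>p. poly p (complex_of_real x)) Q"

definition matcoeff :: "'n::finite matpoly \<Rightarrow> nat \<Rightarrow> complex ^ 'n ^ 'n" where
  "matcoeff Q k = map_matrix (\<lambda>p. coeff p k) Q"

definition matdegree :: "'n::finite matpoly \<Rightarrow> nat" where
  "matdegree Q = Max (range (\<lambda>(i, j). degree (Q $ i $ j)))"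

definition conj_transpose :: "complex ^ 'n ^ 'm \<Rightarrow> complex ^ 'm ^ 'n" where
  "conj_transpose A = map_matrix cnj (transpose A)"

text \<open>The endpoints are extended reals, so that unbounded intervals are allowed. Since the Bochner
  integral of a non-integrable function is \<open>0\<close> by convention, the existence of all the integrals
  is required explicitly, here and in the scalar case below.\<close>

definition orthogonal_matpolys ::
    "ereal \<Rightarrow> ereal \<Rightarrow> (real \<Rightarrow> complex ^ 'n ^ 'n) \<Rightarrow> (nat \<Rightarrow> 'n::finite matpoly) \<Rightarrow> bool" where
  "orthogonal_matpolys x0 x1 W Q \<longleftrightarrow>
     (\<forall>n. matdegree (Q n) = n \<and> invertible (matcoeff (Q n) n)) \<and>
     (\<forall>n m. set_integrable lborel (einterval x0 x1)
        (\<lambda>x. mateval (Q n) x ** W x ** conj_transpose (mateval (Q m) x))) \<and>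
     (\<forall>n m. n \<noteq> m \<longrightarrow>
        (LINT x:einterval x0 x1|lborel.
           mateval (Q n) x ** W x ** conj_transpose (mateval (Q m) x)) = 0)"

definition monic_orthogonal_polys ::
    "ereal \<Rightarrow> ereal \<Rightarrow> (real \<Rightarrow> real) \<Rightarrow> (nat \<Rightarrow> complex poly) \<Rightarrow> bool" where
  "monic_orthogonal_polys x0 x1 w p \<longleftrightarrow>
     (\<forall>n. degree (p n) = n \<and> lead_coeff (p n) = 1) \<and>
     (\<forall>n m. set_integrable lborel (einterval x0 x1)
        (\<lambda>x. poly (p n) (of_real x) * of_real (w x) * cnj (poly (p m) (of_real x)))) \<and>
     (\<forall>n m. n \<noteq> m \<longrightarrow>
        (LINT x:einterval x0 x1|lborel.
           poly (p n) (of_real x) * of_real (w x) * cnj (poly (p m) (of_real x))) = 0)"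

definition laguerre_weight :: "real \<Rightarrow> real \<Rightarrow> real" where
  "laguerre_weight \<beta> x = exp (- x) * x powr \<beta>"

definition W_mat :: "real \<Rightarrow> real \<Rightarrow> real \<Rightarrow> complex ^ 2 ^ 2" where
  "W_mat \<alpha> a x = (exp (- x) * x powr \<alpha>) *\<^sub>R
     vector [vector [of_real (x * (1 + a\<^sup>2 * x)), of_real (a * x)],
             vector [of_real (a * x),            1]]"

definition Q_mat :: "real \<Rightarrow> real \<Rightarrow> (real \<Rightarrow> nat \<Rightarrow> complex poly) \<Rightarrow> nat \<Rightarrow> 2 matpoly" where
  "Q_mat \<alpha> a L n =
     vector
      [vector [smult (of_real (- 1 / a)) (L (\<alpha> + 1) n),
               smult (of_real (\<alpha> + 1)) (L (\<alpha> + 1) n) + [:0, 1:] * pderiv (L (\<alpha> + 1) n)],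
       vector [- pderiv (L \<alpha> n),
               smult (of_real (1 / a)) (L \<alpha> n) + smult (of_real a) ([:0, 1:] * pderiv (L \<alpha> n))]]"

end

theory Submission
  imports Defs
begin

text \<open>Put \<open>w = x\<^sup>\<alpha> e\<^sup>-\<^sup>x\<close>, so that \<open>W = w (v v\<^sup>T + x e\<^sub>1 e\<^sub>1\<^sup>T)\<close> with
  \<open>v = (a x, 1)\<^sup>T\<close>. The two entries of \<open>Q\<^sub>n v\<close> are \<open>D P\<close> and \<open>R / a\<close>, where \<open>P\<close> and \<open>R\<close> are
  the Laguerre polynomials of degree \<open>n\<close> for \<open>\<alpha> + 1\<close> and \<open>\<alpha>\<close>, and \<open>w D p = (x w p)'\<close>.
  Integration by parts, \<open>\<integral> w (D p) q = - \<integral> x w p q'\<close>, then makes the off-diagonal entries of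
  \<open>\<integral> Q\<^sub>n W Q\<^sub>m\<^sup>*\<close> vanish identically, and turns the diagonal ones into integrals of a Laguerre
  polynomial against polynomials of smaller degree.\<close>

section \<open>Integrals of polynomials against the Laguerre weight, and integration by
  parts\<close>

definition lagint :: "real \<Rightarrow> complex poly \<Rightarrow> complex" where
  "lagint \<beta> p = (LINT x:{0<..}|lborel. of_real (laguerre_weight \<beta> x) * poly p (of_real x))"

lemma
  assumes "\<beta> > -1"
  shows integrable_laguerre_weight: "set_integrable lborel {0<..} (laguerre_weight \<beta>)"
    and integral_laguerre_weight: "(LINT x:{0<..}|lborel. laguerre_weight \<beta> x) = Gamma (\<beta> + 1)"
proof -
  \<comment> \<open>The integrands agree pointwise: at \<open>x = 0\<close> the right one vanishes
    too, because \<open>0 powr y = 0\<close>.\<close>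
  have "(\<integral>\<^sup>+x. ennreal (indicator {0<..} x *\<^sub>R laguerre_weight \<beta> x) \<partial>lborel) =
      (\<integral>\<^sup>+x. ennreal (indicator {0..} x * x powr (\<beta> + 1 - 1) / exp x) \<partial>lborel)"
    by (intro nn_integral_cong) (auto simp: indicator_def laguerre_weight_def exp_minus field_simps)
  also have "\<dots> = ennreal (Gamma (\<beta> + 1))"
    using assms by (intro Gamma_conv_nn_integral_real [symmetric]) auto
  finally have "has_bochner_integral lborel (\<lambda>x. indicator {0<..} x *\<^sub>R laguerre_weight \<beta> x) (Gamma (\<beta> + 1))"
    using assms by (intro has_bochner_integral_nn_integral) (auto simp: laguerre_weight_def)
  then show "set_integrable lborel {0<..} (laguerre_weight \<beta>)"
    and "(LINT x:{0<..}|lborel. laguerre_weight \<beta> x) = Gamma (\<beta> + 1)"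
    unfolding set_integrable_def set_lebesgue_integral_def by (auto simp: has_bochner_integral_iff)
qed

lemma laguerre_weight_plus1: "x > 0 \<Longrightarrow> laguerre_weight (\<beta> + 1) x = x * laguerre_weight \<beta> x"
  by (simp add: laguerre_weight_def powr_add)

text \<open>The factor \<open>x\<close> hidden in \<open>pCons\<close> is absorbed by raising
  \<beta> by one, which is why \<beta> varies in the induction.\<close>

lemma integrable_laguerre_poly:
  "\<beta> > -1 \<Longrightarrow> set_integrable lborel {0<..} (\<lambda>x. complex_of_real (laguerre_weight \<beta> x) * poly p (of_real x))"
proof (induction p arbitrary: \<beta>)
  case 0
  show ?case by (simp add: set_integrable_def)
next
  case (pCons c p)
  have "set_integrable lborel {0<..} (\<lambda>x. complex_of_real (laguerre_weight \<beta> x))"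
    using integrable_laguerre_weight [OF pCons.prems]
    by (simp add: set_integrable_def scaleR_conv_of_real flip: of_real_mult)
  moreover have "set_integrable lborel {0<..}
      (\<lambda>x. complex_of_real (laguerre_weight (\<beta> + 1) x) * poly p (of_real x))"
    using pCons by simp
  ultimately have "set_integrable lborel {0<..} (\<lambda>x. complex_of_real (laguerre_weight \<beta> x) * c +
      complex_of_real (laguerre_weight (\<beta> + 1) x) * poly p (of_real x))"
    by auto
  then show ?case
    by (rule set_integrable_cong [THEN iffD1, rotated 3])
      (auto simp: laguerre_weight_plus1 distrib_left mult_ac)
qed

lemma lagint_add:
  assumes "\<beta> > -1"
  shows "lagint \<beta> (p + q) = lagint \<beta> p + lagint \<beta> q"
  using set_integral_add(2) [OF integrable_laguerre_poly [OF assms] integrable_laguerre_poly [OF assms], of p q]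
  by (simp add: lagint_def distrib_left)

lemma lagint_smult: "lagint \<beta> (smult c p) = c * lagint \<beta> p"
  by (simp add: lagint_def mult.left_commute flip: set_integral_mult_right)

lemma lagint_X: "lagint (\<beta> + 1) p = lagint \<beta> (pCons 0 p)"
  unfolding lagint_def by (intro set_lebesgue_integral_cong) (auto simp: laguerre_weight_plus1)

lemma lagint_const: "\<beta> > -1 \<Longrightarrow> lagint \<beta> [:c:] = c * of_real (Gamma (\<beta> + 1))"
  by (simp add: lagint_def set_integral_complex_of_real integral_laguerre_weight)

text \<open>The derivative of \<open>x w p\<close> divided by the weight \<open>w = x\<^sup>\<alpha> e\<^sup>-\<^sup>x\<close>.\<close>

definition lagD :: "real \<Rightarrow> complex poly \<Rightarrow> complex poly" where
  "lagD \<alpha> p = [:of_real (\<alpha> + 1), -1:] * p + [:0, 1:] * pderiv p"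

text \<open>Stated for all \<open>\<alpha>\<close> at once, this follows by induction on \<open>p\<close> from the functional equation
  of the Gamma function: a factor \<open>x\<close> is absorbed by passing from \<open>\<alpha>\<close> to \<open>\<alpha> + 1\<close>.\<close>

lemma lagint_lagD: "\<alpha> > -1 \<Longrightarrow> lagint \<alpha> (lagD \<alpha> p) = 0"
proof (induction p arbitrary: \<alpha>)
  case 0
  show ?case by (simp add: lagD_def lagint_def)
next
  case (pCons c p)
  \<comment> \<open>The recursion rests on
    \<open>lagD \<alpha> (pCons 0 p) = pCons 0 (lagD (\<alpha> + 1) p)\<close>; the other two terms
    are the contribution of the constant \<open>c\<close>.\<close>
  have *: "lagD \<alpha> (pCons c p) = [:c * of_real (\<alpha> + 1):] + pCons 0 ([:- c:] + lagD (\<alpha> + 1) p)"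
    by (intro poly_ext) (simp add: lagD_def pderiv_pCons algebra_simps)
  have "Gamma (\<alpha> + 1 + 1) = (\<alpha> + 1) * Gamma (\<alpha> + 1)"
    using pCons.prems by (intro Gamma_plus1) (auto elim!: nonpos_Ints_cases)
  then have "lagint \<alpha> [:c * of_real (\<alpha> + 1):] + lagint (\<alpha> + 1) [:- c:] = 0"
    using pCons.prems by (simp add: lagint_const)
  moreover have "lagint (\<alpha> + 1) (lagD (\<alpha> + 1) p) = 0"
    using pCons by simp
  ultimately show ?case
    using pCons.prems unfolding * by (simp only: lagint_add lagint_X [symmetric]) (simp add: lagint_add)
qed

text \<open>\<open>lagD\<close> obeys a product rule in which the derivative of \<open>q\<close>
  carries a factor \<open>x\<close>. That factor turns \<alpha> into \<alpha> + 1, and the left side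
  of the rule integrates to zero by \<open>lagint_lagD\<close>.\<close>

lemma lagint_by_parts:
  assumes "\<alpha> > -1"
  shows "lagint \<alpha> (lagD \<alpha> p * q) = - lagint (\<alpha> + 1) (p * pderiv q)"
proof -
  have "lagD \<alpha> (p * q) = lagD \<alpha> p * q + [:0, 1:] * (p * pderiv q)"
    by (simp add: lagD_def pderiv_mult algebra_simps)
  then show ?thesis
    using lagint_lagD [OF assms, of "p * q"] assms
    by (simp add: lagint_add eq_neg_iff_add_eq_0 flip: lagint_X)
qed

section \<open>Orthogonality to all polynomials of smaller degree\<close>

text \<open>The family \<open>r\<close> has one nonzero member in each degree, so subtracting a
  multiple of \<open>r k\<close> lowers the degree of \<open>q\<close>. Keeping \<open>r\<close>
  abstract serves both the orthogonal polynomials and their conjugates.\<close>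

lemma lagint_orthogonal_lower_degree:
  assumes "\<beta> > -1" and deg: "\<And>n. degree (r n) = n" and nz: "\<And>n. r n \<noteq> 0"
    and orth: "\<And>m. m \<noteq> n \<Longrightarrow> lagint \<beta> (p * r m) = 0"
    and "degree q < n"
  shows "lagint \<beta> (p * q) = 0"
  using assms(5)
proof (induction "degree q" arbitrary: q rule: less_induct)
  case less
  define k c where "k = degree q" and "c = lead_coeff q / lead_coeff (r k)"
  define s where "s = q - smult c (r k)"
  have q: "q = s + smult c (r k)"
    by (simp add: s_def)
  have "lagint \<beta> (p * s) = 0"
  \<comment> \<open>Zero has degree \<open>0\<close>, so for constant \<open>q\<close> the remainder
    is not of smaller degree and is treated apart.\<close>
  proof (cases "s = 0")
    case True
    then show ?thesis by (simp add: lagint_def)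
  next
    case False
    have "degree s \<le> k"
      unfolding s_def using deg [of k]
      by (intro degree_diff_le order_trans [OF degree_smult_le]) (simp_all add: k_def)
    moreover have "coeff (r k) k \<noteq> 0"
      using nz [of k] deg [of k] by (metis leading_coeff_0_iff)
    then have "coeff s k = 0"
      using deg [of k] by (simp add: s_def c_def k_def)
    ultimately have "degree s < k \<or> s = 0"
      by (metis le_neq_implies_less leading_coeff_0_iff)
    with False less show ?thesis
      by (auto simp: k_def)
  qed
  moreover have "lagint \<beta> (p * r k) = 0"
    using less.prems by (intro orth) (simp add: k_def)
  ultimately show ?case
    using assms(1) by (subst q) (simp add: distrib_left lagint_add lagint_smult)
qed

section \<open>Coefficientwise conjugation, which at real points conjugates the values\<close>

lemma degree_map_poly_cnj [simp]: "degree (map_poly cnj p) = degree p"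
  by (rule degree_map_poly) auto

lemma map_poly_cnj_eq_0_iff [simp]: "map_poly cnj p = 0 \<longleftrightarrow> p = 0"
  by (simp add: poly_eq_iff coeff_map_poly)

lemma map_poly_cnj_add: "map_poly cnj (p + q) = map_poly cnj p + map_poly cnj q"
  by (simp add: poly_eq_iff coeff_map_poly)

lemma map_poly_cnj_smult: "map_poly cnj (smult c p) = smult (cnj c) (map_poly cnj p)"
  by (simp add: poly_eq_iff coeff_map_poly)

lemma map_poly_cnj_uminus: "map_poly cnj (- p) = - map_poly cnj p"
  by (simp add: poly_eq_iff coeff_map_poly)

lemma map_poly_cnj_pCons: "map_poly cnj (pCons c p) = pCons (cnj c) (map_poly cnj p)"
  by (simp add: map_poly_pCons)

lemma map_poly_cnj_pderiv: "map_poly cnj (pderiv p) = pderiv (map_poly cnj p)"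
  by (simp add: poly_eq_iff coeff_map_poly coeff_pderiv)

text \<open>The pairing is sesquilinear, so orthogonality is needed with \<open>p n\<close> in
  either factor. The test polynomials are expanded in the conjugated family in the first case and in
  the family itself in the second.\<close>

lemma monic_orthogonal_polys_laguerreD:
  assumes "monic_orthogonal_polys 0 \<infinity> (laguerre_weight \<beta>) p" and "\<beta> > -1"
  shows "degree (p n) = n" and "coeff (p n) n = 1" and "p n \<noteq> 0"
    and "degree q < n \<Longrightarrow> lagint \<beta> (p n * q) = 0"
    and "degree q < n \<Longrightarrow> lagint \<beta> (q * map_poly cnj (p n)) = 0"
proof -
  have deg_lead: "degree (p n) = n \<and> lead_coeff (p n) = 1"
    and orth': "n \<noteq> m \<Longrightarrow> (LINT x:einterval 0 \<infinity>|lborel.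
      poly (p n) (of_real x) * of_real (laguerre_weight \<beta> x) * cnj (poly (p m) (of_real x))) = 0" for n m
    using assms(1) unfolding monic_orthogonal_polys_def by blast+
  have deg: "degree (p n) = n" and lead: "coeff (p n) n = 1" for n
    using deg_lead [of n] by auto
  have nz: "p n \<noteq> 0" for n
    using lead [of n] by auto
  have orth: "lagint \<beta> (p n * map_poly cnj (p m)) = 0" if "n \<noteq> m" for n m
    using orth' [OF that] by (simp add: lagint_def zero_ereal_def mult_ac)
  show "degree (p n) = n" "coeff (p n) n = 1" "p n \<noteq> 0"
    by (rule deg lead nz)+
  show "lagint \<beta> (p n * q) = 0" if "degree q < n"
  proof (rule lagint_orthogonal_lower_degree [OF assms(2) _ _ _ that])
    show "degree (map_poly cnj (p m)) = m" "map_poly cnj (p m) \<noteq> 0" for m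
      by (simp_all add: deg nz)
  qed (rule orth, simp)
  show "lagint \<beta> (q * map_poly cnj (p n)) = 0" if "degree q < n"
    unfolding mult.commute [of q]
  proof (rule lagint_orthogonal_lower_degree [OF assms(2) deg nz _ that])
    show "lagint \<beta> (map_poly cnj (p n) * p m) = 0" if "m \<noteq> n" for m
      using orth [OF that] by (simp only: mult.commute)
  qed
qed

section \<open>Reduction of matrix integrals to scalar ones\<close>

lemma set_integral_matrix_entries:
  fixes F :: "real \<Rightarrow> complex ^ 'n::finite ^ 'm::finite"
  assumes "\<And>i j. set_integrable M A (\<lambda>x. F x $ i $ j)"
  shows "set_integrable M A F"
    and "(LINT x:A|M. F x) $ i $ j = (LINT x:A|M. F x $ i $ j)"
proof -
  have bl: "bounded_linear (\<lambda>z. axis i (axis j z) :: complex ^ 'n ^ 'm)" for i j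
    by (rule linear_conv_bounded_linear [THEN iffD1], rule linearI)
      (auto simp: vec_eq_iff axis_def)
  have sum_if: "(\<Sum>y\<in>UNIV. if b then f y else 0) = (if b then \<Sum>y\<in>UNIV. f y else 0)"
    for b and f :: "'n \<Rightarrow> complex"
    by simp
  \<comment> \<open>Expansion in matrix units: integrability of \<open>F\<close> then follows from
    that of finitely many bounded linear images of its entries.\<close>
  have eq: "indicator A x *\<^sub>R F x = (\<Sum>i\<in>UNIV. \<Sum>j\<in>UNIV. axis i (axis j (indicator A x *\<^sub>R F x $ i $ j)))" for x
    by (simp add: vec_eq_iff axis_def sum_if if_distrib [where f = "\<lambda>v. v $ _"] cong: if_cong)
  have int: "integrable M (\<lambda>x. indicator A x *\<^sub>R F x)"
    unfolding eq using assms unfolding set_integrable_def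
    by (intro Bochner_Integration.integrable_sum integrable_bounded_linear [OF bl])
  then show "set_integrable M A F"
    by (simp add: set_integrable_def)
  have "bounded_linear (\<lambda>v :: complex ^ 'n ^ 'm. v $ i $ j)"
    using bounded_linear_compose [OF bounded_linear_vec_nth bounded_linear_vec_nth] by blast
  from integral_bounded_linear [OF this int]
  show "(LINT x:A|M. F x) $ i $ j = (LINT x:A|M. F x $ i $ j)"
    by (simp add: set_lebesgue_integral_def)
qed

text \<open>The polynomial factor of \<open>P W Q\<^sup>*\<close>, split along \<open>v v\<^sup>T + x e\<^sub>1 e\<^sub>1\<^sup>T\<close>.\<close>

definition gram :: "real \<Rightarrow> 2 matpoly \<Rightarrow> 2 matpoly \<Rightarrow> 2 matpoly" where
  "gram a P Q = (\<chi> i j.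
     ([:0, of_real a:] * P $ i $ 1 + P $ i $ 2) * ([:0, of_real a:] * map_poly cnj (Q $ j $ 1) + map_poly cnj (Q $ j $ 2))
      + [:0, 1:] * (P $ i $ 1 * map_poly cnj (Q $ j $ 1)))"

lemma W_mat_gram:
  "(mateval P x ** W_mat \<alpha> a x ** conj_transpose (mateval Q x)) $ i $ j =
     of_real (laguerre_weight \<alpha> x) * poly (gram a P Q $ i $ j) (of_real x)"
  by (simp add: matrix_matrix_mult_def mateval_def map_matrix_def W_mat_def conj_transpose_def
      transpose_def sum_2 gram_def laguerre_weight_def scaleR_conv_of_real [where 'a = complex] power2_eq_square
      algebra_simps)

lemma
  assumes "\<alpha> > -1"
  shows W_mat_integrable: "set_integrable lborel {0<..}
      (\<lambda>x. mateval P x ** W_mat \<alpha> a x ** conj_transpose (mateval Q x))"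
    and W_mat_integral: "(LINT x:{0<..}|lborel.
      mateval P x ** W_mat \<alpha> a x ** conj_transpose (mateval Q x)) $ i $ j = lagint \<alpha> (gram a P Q $ i $ j)"
  using set_integral_matrix_entries [of lborel "{0<..}" 
      "\<lambda>x. mateval P x ** W_mat \<alpha> a x ** conj_transpose (mateval Q x)"]
    integrable_laguerre_poly [OF assms]
  by (simp_all add: W_mat_gram lagint_def)

text \<open>Off the diagonal the two summands are exactly those of the product rule for
  \<open>lagD\<close>, so they integrate to zero even for \<open>n = m\<close>.\<close>

lemma gram_Q_mat:
  fixes \<alpha> a :: real and L :: "real \<Rightarrow> nat \<Rightarrow> complex poly"
  assumes "a \<noteq> 0"
  defines "P \<equiv> L (\<alpha> + 1)" and "R \<equiv> L \<alpha>"
  shows "gram a (Q_mat \<alpha> a L n) (Q_mat \<alpha> a L m) $ 1 $ 1 =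
      lagD \<alpha> (P n) * lagD \<alpha> (map_poly cnj (P m)) +
      smult (of_real (1 / a\<^sup>2)) ([:0, 1:] * (P n * map_poly cnj (P m)))"
    and "gram a (Q_mat \<alpha> a L n) (Q_mat \<alpha> a L m) $ 1 $ 2 =
      smult (of_real (1 / a)) (lagD \<alpha> (P n) * map_poly cnj (R m) +
        [:0, 1:] * (P n * pderiv (map_poly cnj (R m))))"
    and "gram a (Q_mat \<alpha> a L n) (Q_mat \<alpha> a L m) $ 2 $ 1 =
      smult (of_real (1 / a)) (lagD \<alpha> (map_poly cnj (P m)) * R n +
        [:0, 1:] * (map_poly cnj (P m) * pderiv (R n)))"
    and "gram a (Q_mat \<alpha> a L n) (Q_mat \<alpha> a L m) $ 2 $ 2 =
      smult (of_real (1 / a\<^sup>2)) (R n * map_poly cnj (R m)) +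
      [:0, 1:] * (pderiv (R n) * pderiv (map_poly cnj (R m)))"
proof -
  have 1: "[:0, of_real a:] * Q_mat \<alpha> a L n $ 1 $ 1 + Q_mat \<alpha> a L n $ 1 $ 2 = lagD \<alpha> (P n)"
    and 2: "[:0, of_real a:] * Q_mat \<alpha> a L n $ 2 $ 1 + Q_mat \<alpha> a L n $ 2 $ 2 = smult (of_real (1 / a)) (R n)" for n
    using assms(1) by (simp_all add: Q_mat_def P_def R_def lagD_def)
  \<comment> \<open>The coefficients in \<open>lagD \<alpha>\<close> are real, so it commutes with
    conjugation.\<close>
  have 3: "[:0, of_real a:] * map_poly cnj (Q_mat \<alpha> a L n $ 1 $ 1) + map_poly cnj (Q_mat \<alpha> a L n $ 1 $ 2) =
      lagD \<alpha> (map_poly cnj (P n))"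
    and 4: "[:0, of_real a:] * map_poly cnj (Q_mat \<alpha> a L n $ 2 $ 1) + map_poly cnj (Q_mat \<alpha> a L n $ 2 $ 2) =
      smult (of_real (1 / a)) (map_poly cnj (R n))" for n
    using assms(1) by (simp_all add: Q_mat_def P_def R_def lagD_def map_poly_cnj_add map_poly_cnj_smult
      map_poly_cnj_uminus map_poly_cnj_pCons map_poly_cnj_pderiv)
  show "gram a (Q_mat \<alpha> a L n) (Q_mat \<alpha> a L m) $ 1 $ 1 =
      lagD \<alpha> (P n) * lagD \<alpha> (map_poly cnj (P m)) +
      smult (of_real (1 / a\<^sup>2)) ([:0, 1:] * (P n * map_poly cnj (P m)))"
    and "gram a (Q_mat \<alpha> a L n) (Q_mat \<alpha> a L m) $ 1 $ 2 =
      smult (of_real (1 / a)) (lagD \<alpha> (P n) * map_poly cnj (R m) +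
        [:0, 1:] * (P n * pderiv (map_poly cnj (R m))))"
    and "gram a (Q_mat \<alpha> a L n) (Q_mat \<alpha> a L m) $ 2 $ 1 =
      smult (of_real (1 / a)) (lagD \<alpha> (map_poly cnj (P m)) * R n +
        [:0, 1:] * (map_poly cnj (P m) * pderiv (R n)))"
    and "gram a (Q_mat \<alpha> a L n) (Q_mat \<alpha> a L m) $ 2 $ 2 =
      smult (of_real (1 / a\<^sup>2)) (R n * map_poly cnj (R m)) +
      [:0, 1:] * (pderiv (R n) * pderiv (map_poly cnj (R m)))"
    unfolding gram_def vec_lambda_beta 1 2 3 4
    by (simp_all add: Q_mat_def P_def R_def map_poly_cnj_smult map_poly_cnj_uminus map_poly_cnj_pderiv
      smult_add_right power2_eq_square mult_ac)
qed

section \<open>Degree bounds and vanishing of the integrals\<close>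

lemma degree_X_pderiv_le: "degree ([:0, 1:] * pderiv p) \<le> degree p" for p :: "complex poly"
  by (intro degree_le) (auto simp: coeff_pCons coeff_pderiv coeff_eq_0 split: nat.split)

lemma degree_lagD_le: "degree (lagD \<alpha> p) \<le> Suc (degree p)"
  unfolding lagD_def
  by (intro degree_add_le order_trans [OF degree_mult_le] order_trans [OF degree_X_pderiv_le]) auto

lemma lagint_gram_Q_mat:
  assumes "\<alpha> > -1" "a \<noteq> 0" "n \<noteq> m"
    and mop: "\<And>\<beta>. \<beta> > -1 \<Longrightarrow> monic_orthogonal_polys 0 \<infinity> (laguerre_weight \<beta>) (L \<beta>)"
  shows "lagint \<alpha> (gram a (Q_mat \<alpha> a L n) (Q_mat \<alpha> a L m) $ i $ j) = 0"
proof -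
  note L = monic_orthogonal_polys_laguerreD [OF mop]
  have deg [simp]: "degree (L \<beta> n) = n" if "\<beta> > -1" for \<beta> n
    using that L(1) by blast
  have \<alpha>: "\<alpha> + 1 > -1"
    using assms(1) by simp
  have orth: "lagint \<beta> (L \<beta> n * map_poly cnj (L \<beta> m)) = 0" if "\<beta> > -1" for \<beta>
    using assms(3) that L(4) [of \<beta> "map_poly cnj (L \<beta> m)" n] L(5) [of \<beta> "L \<beta> n" m] by (cases "m < n") auto
  have d: "degree (pderiv (lagD \<alpha> p)) \<le> degree p" for p
    using degree_lagD_le [of \<alpha> p] by (simp add: degree_pderiv)
  have d': "degree (lagD \<alpha> (pderiv p)) \<le> degree p" for p
  \<comment> \<open>For constant \<open>p\<close> the derivative still has degree \<open>0\<close>,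
    and \<open>degree_lagD_le\<close> would only give the bound \<open>1\<close>.\<close>
  proof (cases "degree p")
    case 0
    then show ?thesis
      by (auto simp: lagD_def elim!: degree_eq_zeroE)
  next
    case (Suc k)
    then show ?thesis
      using degree_lagD_le [of \<alpha> "pderiv p"] by (simp add: degree_pderiv)
  qed
  \<comment> \<open>Integration by parts strips \<open>lagD\<close> from the factor of larger
    degree; on the other side differentiation undoes the rise in degree caused by
    \<open>lagD\<close>.\<close>
  have 11: "lagint \<alpha> (lagD \<alpha> (L (\<alpha> + 1) n) * lagD \<alpha> (map_poly cnj (L (\<alpha> + 1) m))) = 0"
  proof (cases "m < n")
    case True
    then have "degree (pderiv (lagD \<alpha> (map_poly cnj (L (\<alpha> + 1) m)))) < n"
      using d \<alpha> by (metis deg degree_map_poly_cnj le_less_trans)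
    then show ?thesis
      using L(4) [OF \<alpha> \<alpha>] by (simp add: lagint_by_parts assms(1))
  next
    case False
    with assms(3) have "degree (pderiv (lagD \<alpha> (L (\<alpha> + 1) n))) < m"
      using d \<alpha> by (metis deg le_less_trans linorder_neqE_nat)
    then have "lagint (\<alpha> + 1) (pderiv (lagD \<alpha> (L (\<alpha> + 1) n)) * map_poly cnj (L (\<alpha> + 1) m)) = 0"
      by (rule L(5) [OF \<alpha> \<alpha>])
    then show ?thesis
      using lagint_by_parts [OF assms(1), of "map_poly cnj (L (\<alpha> + 1) m)" "lagD \<alpha> (L (\<alpha> + 1) n)"]
      by (simp add: mult.commute)
  qed
  \<comment> \<open>Integration by parts is read backwards: it undoes the derivative of the factor
    of larger degree and applies \<open>lagD\<close> to the derivative of the other.\<close>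
  have 22: "lagint (\<alpha> + 1) (pderiv (L \<alpha> n) * pderiv (map_poly cnj (L \<alpha> m))) = 0"
  proof (cases "n < m")
    case True
    then have "degree (lagD \<alpha> (pderiv (L \<alpha> n))) < m"
      using d' assms(1) by (metis deg le_less_trans)
    then have "lagint \<alpha> (lagD \<alpha> (pderiv (L \<alpha> n)) * map_poly cnj (L \<alpha> m)) = 0"
      by (rule L(5) [OF assms(1) assms(1)])
    then show ?thesis
      by (simp add: lagint_by_parts assms(1))
  next
    case False
    with assms(3) have "degree (lagD \<alpha> (pderiv (map_poly cnj (L \<alpha> m)))) < n"
      using d' assms(1) by (metis deg degree_map_poly_cnj le_less_trans linorder_neqE_nat)
    then have "lagint \<alpha> (lagD \<alpha> (pderiv (map_poly cnj (L \<alpha> m))) * L \<alpha> n) = 0"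
      by (subst mult.commute) (rule L(4) [OF assms(1) assms(1)])
    then show ?thesis
      using lagint_by_parts [OF assms(1), of "pderiv (map_poly cnj (L \<alpha> m))" "L \<alpha> n"]
      by (simp add: mult.commute)
  qed
  have "i = 1 \<or> i = 2" "j = 1 \<or> j = 2"
    using exhaust_2 by blast+
  then show ?thesis
    using assms(1) 11 22 orth [OF \<alpha>] orth [OF assms(1)]
    by (auto simp: gram_Q_mat [OF assms(2)] lagint_add lagint_smult lagint_by_parts simp flip: lagint_X)
qed

theorem corollary4p2:
  fixes \<alpha> a :: real and L :: "real \<Rightarrow> nat \<Rightarrow> complex poly"
  assumes "\<alpha> > -1" and "a \<noteq> 0"
    and "\<And>\<beta>. \<beta> > -1 \<Longrightarrow> monic_orthogonal_polys 0 \<infinity> (laguerre_weight \<beta>) (L \<beta>)"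
  shows "orthogonal_matpolys 0 \<infinity> (W_mat \<alpha> a) (Q_mat \<alpha> a L)"
proof -
  note L = monic_orthogonal_polys_laguerreD [OF assms(3)]
  have \<alpha>: "\<alpha> + 1 > -1"
    using assms(1) by simp
  let ?Q = "Q_mat \<alpha> a L"
  have deg_le: "degree (?Q n $ i $ j) \<le> n" for n i j
  proof -
    have "degree (pderiv (L \<alpha> n)) \<le> n"
      using L(1) [OF assms(1) assms(1), of n] by (simp add: degree_pderiv)
    then have "\<forall>i j. degree (?Q n $ i $ j) \<le> n"
      using L(1) [OF assms(1) assms(1), of n] L(1) [OF \<alpha> \<alpha>, of n]
        degree_X_pderiv_le [of "L \<alpha> n"] degree_X_pderiv_le [of "L (\<alpha> + 1) n"]
      unfolding forall_2 Q_mat_def vector_2 degree_minus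
      by (intro conjI degree_add_le order_trans [OF degree_smult_le]) auto
    then show ?thesis
      by blast
  qed
  have deg_eq: "degree (?Q n $ 1 $ 1) = n" for n
    using L(1) [OF \<alpha> \<alpha>, of n] assms(2) by (simp add: Q_mat_def)
  have "matdegree (?Q n) = n" for n
    unfolding matdegree_def
  proof (rule Max_eqI)
    show "n \<in> range (\<lambda>(i, j). degree (?Q n $ i $ j))"
      using deg_eq [of n] by (intro range_eqI [of _ _ "(1, 1)"]) simp
  qed (auto intro: deg_le)
  moreover have "invertible (matcoeff (?Q n) n)" for n
  proof -
    have c: "coeff ([:0, 1:] * pderiv p) n = of_nat n * coeff p n" for p :: "complex poly"
      by (cases n) (simp_all add: coeff_pderiv)
    have "coeff (pderiv (L \<alpha> n)) n = 0"
      using L(1) [OF assms(1) assms(1), of n] by (simp add: coeff_pderiv coeff_eq_0)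
    \<comment> \<open>The leading coefficient is upper triangular, since the lower left entry is a
      derivative; \<open>real n\<close> comes from \<open>x\<close> times a derivative.\<close>
    then have "det (matcoeff (?Q n) n) = - of_real ((1 / a) * (1 / a + a * real n))"
      using L(2) [OF assms(1) assms(1), of n] L(2) [OF \<alpha> \<alpha>, of n]
      unfolding det_2 matcoeff_def map_matrix_def Q_mat_def
      by (simp add: c del: mult_pCons_left)
    moreover have "1 / a + a * real n = (1 + a\<^sup>2 * real n) / a"
      using assms(2) by (simp add: field_simps power2_eq_square)
    \<comment> \<open>Since \<open>a\<close> is real, this factor of the determinant cannot
      vanish.\<close>
    moreover have "1 + a\<^sup>2 * real n > 0"
      by (simp add: add_pos_nonneg)
    ultimately show ?thesis
      using assms(2) by (simp add: invertible_det_nz del: of_real_mult of_real_add of_real_divide)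
  qed
  moreover have "einterval 0 \<infinity> = {0::real<..}"
    by (simp add: zero_ereal_def)
  ultimately show ?thesis
    unfolding orthogonal_matpolys_def
    using W_mat_integrable [OF assms(1)] lagint_gram_Q_mat [OF assms(1,2) _ assms(3)]
    by (auto simp: vec_eq_iff W_mat_integral [OF assms(1)])
qed

end
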